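(* Let $r\ge 1$, $0<c<1$, and let $\beta_1,\ldots,\beta_r>0$ satisfy $\beta_i-\beta_j\notin\mathbb{Z}$ whenever $i\neq j$. Let $M^{(2)}_{\vec n}$, $\vec n=(n_1,\ldots,n_r)\in\mathbb{N}^r$, be the multiple Meixner polynomials of the second kind with parameters $\beta_1,\ldots,\beta_r$ and $c$. Then $$\sum_{n_1=0}^\infty\cdots\sum_{n_r=0}^\infty M^{(2)}_{\vec n}(x)\,\frac{t_1^{n_1}\cdots t_r^{n_r}}{n_1!\cdots n_r!}=\left(1-\frac1c\left[1-\prod_{j=1}^r\left(1+\frac{c}{1-c}t_j\right)\right]\right)^{x}\prod_{j=1}^r\left(1+\frac{c}{1-c}t_j\right)^{-x-\beta_j},$$ as an identity of power series in $t_1,\ldots,t_r$.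
   Context: $\mathbb{N}=\{0,1,2,\ldots\}$. For a multi-index $\vec n=(n_1,\ldots,n_r)\in\mathbb{N}^r$, $|\vec n|=n_1+\cdots+n_r$. The Pochhammer symbol is $(a)_0=1$, $(a)_k=a(a+1)\cdots(a+k-1)$. The multiple Meixner polynomial of the second kind $M^{(2)}_{\vec n}$ (with parameters $\beta_1,\ldots,\beta_r>0$, $\beta_i-\beta_j\notin\mathbb{Z}$ for $i\ne j$, and $0<c<1$) is the unique monic polynomial of degree $|\vec n|$ in one variable satisfying $$\sum_{k=0}^\infty M^{(2)}_{\vec n}(k)\,k^\ell\,\frac{(\beta_j)_k c^k}{k!}=0,\qquad \ell=0,1,\ldots,n_j-1,\quad j=1,\ldots,r.$$ On the right-hand side of the identity, each base has constant term $1$ as a polynomial in $t_1,\ldots,t_r$, and a power $(1+u)^{y}$ is understood as the binomial series $\sum_{n\ge0}\binom{y}{n}u^n$; coefficients are polynomials in $x$. *)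

theory Defs
  imports Complex_Main "HOL-Computational_Algebra.Polynomial"
begin

section \<open>Formal power series in variables indexed by a finite type\<close>

text \<open>
  An element of type \<open>('v, 'a) mfps\<close> is given by its coefficients: a multi-index
  \<open>n :: 'v \<Rightarrow> nat\<close> stands for the monomial whose exponent at the variable \<open>i\<close> is \<open>n i\<close>.
\<close>

typedef ('v, 'a) mfps = "UNIV :: (('v \<Rightarrow> nat) \<Rightarrow> 'a) set"
  morphisms mfps_nth Abs_mfps
  by simp

lemma mfps_nth_Abs_mfps [simp]: "mfps_nth (Abs_mfps f) = f"
  by (simp add: Abs_mfps_inverse)

lemma mfps_eqI: "(\<And>n. mfps_nth f n = mfps_nth g n) \<Longrightarrow> f = g"
  by (simp add: mfps_nth_inject [symmetric] fun_eq_iff)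

definition mdegree :: "('v::finite \<Rightarrow> nat) \<Rightarrow> nat" where
  "mdegree n = (\<Sum>i\<in>UNIV. n i)"

definition msplits :: "('v \<Rightarrow> nat) \<Rightarrow> (('v \<Rightarrow> nat) \<times> ('v \<Rightarrow> nat)) set" where
  "msplits n = {(k, l). (\<lambda>i. k i + l i) = n}"

lemma finite_msplits [simp]: "finite (msplits (n :: 'v::finite \<Rightarrow> nat))"
proof -
  have "finite {f :: 'v \<Rightarrow> nat. \<forall>i. (i \<in> UNIV \<longrightarrow> f i \<in> {..mdegree n}) \<and> (i \<notin> UNIV \<longrightarrow> f i = 0)}"
    by (rule finite_set_of_finite_funs) simp_all
  then have "finite {f :: 'v \<Rightarrow> nat. \<forall>i. f i \<le> mdegree n}"
    by simp
  moreover have "n i \<le> mdegree n" for i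
    unfolding mdegree_def by (rule member_le_sum) simp_all
  then have "{f. \<forall>i. f i \<le> n i} \<subseteq> {f. \<forall>i. f i \<le> mdegree n}"
    using le_trans by blast
  ultimately have "finite {f. \<forall>i. f i \<le> n i}"
    by (rule rev_finite_subset)
  moreover have "msplits n \<subseteq> {f. \<forall>i. f i \<le> n i} \<times> {f. \<forall>i. f i \<le> n i}"
    by (auto simp: msplits_def)
  ultimately show ?thesis
    by (meson finite_SigmaI finite_subset)
qed

instantiation mfps :: (type, zero) zero
begin
definition "0 = Abs_mfps (\<lambda>_. 0)"
instance ..
end

instantiation mfps :: (type, "{zero, one}") one
begin
definition "1 = Abs_mfps (\<lambda>n. if n = (\<lambda>_. 0) then 1 else 0)"
instance ..
end

instantiation mfps :: (type, plus) plus
begin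
definition "f + g = Abs_mfps (\<lambda>n. mfps_nth f n + mfps_nth g n)"
instance ..
end

instantiation mfps :: (type, minus) minus
begin
definition "f - g = Abs_mfps (\<lambda>n. mfps_nth f n - mfps_nth g n)"
instance ..
end

instantiation mfps :: (type, uminus) uminus
begin
definition "- f = Abs_mfps (\<lambda>n. - mfps_nth f n)"
instance ..
end

instantiation mfps :: (finite, "{comm_monoid_add, times}") times
begin
definition "f * g = Abs_mfps (\<lambda>n. \<Sum>(k, l)\<in>msplits n. mfps_nth f k * mfps_nth g l)"
instance ..
end

lemma mfps_nth_zero [simp]: "mfps_nth 0 n = 0"
  by (simp add: zero_mfps_def)

lemma mfps_nth_one: "mfps_nth 1 n = (if n = (\<lambda>_. 0) then 1 else 0)"
  by (simp add: one_mfps_def)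

lemma mfps_nth_add [simp]: "mfps_nth (f + g) n = mfps_nth f n + mfps_nth g n"
  by (simp add: plus_mfps_def)

lemma mfps_nth_diff [simp]: "mfps_nth (f - g) n = mfps_nth f n - mfps_nth g n"
  by (simp add: minus_mfps_def)

lemma mfps_nth_uminus [simp]: "mfps_nth (- f) n = - mfps_nth f n"
  by (simp add: uminus_mfps_def)

lemma mfps_nth_mult:
  "mfps_nth (f * g) n = (\<Sum>(k, l)\<in>msplits n. mfps_nth f k * mfps_nth g l)"
  by (simp add: times_mfps_def)

lemma mfps_mult_commute: "f * g = g * (f :: ('v::finite, 'a::comm_semiring_0) mfps)"
proof (rule mfps_eqI)
  fix n
  have "(\<Sum>(k, l)\<in>msplits n. mfps_nth f k * mfps_nth g l) =
        (\<Sum>(k, l)\<in>msplits n. mfps_nth g k * mfps_nth f l)"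
    by (rule sum.reindex_bij_witness [of _ prod.swap prod.swap])
       (auto simp: msplits_def add.commute mult.commute)
  then show "mfps_nth (f * g) n = mfps_nth (g * f) n"
    by (simp add: mfps_nth_mult)
qed

lemma mfps_mult_assoc: "(f * g) * h = f * (g * (h :: ('v::finite, 'a::comm_semiring_0) mfps))"
proof (rule mfps_eqI)
  fix n
  have "mfps_nth ((f * g) * h) n =
      (\<Sum>(k, l)\<in>msplits n. \<Sum>(a, b)\<in>msplits k. mfps_nth f a * mfps_nth g b * mfps_nth h l)"
    by (simp add: mfps_nth_mult sum_distrib_right case_prod_beta)
  also have "\<dots> = (\<Sum>((k, l), (a, b))\<in>Sigma (msplits n) (\<lambda>(k, l). msplits k).
      mfps_nth f a * mfps_nth g b * mfps_nth h l)"
    by (subst sum.Sigma [symmetric]) (auto simp: case_prod_beta)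
  also have "\<dots> = (\<Sum>((a, m), (b, l))\<in>Sigma (msplits n) (\<lambda>(a, m). msplits m).
      mfps_nth f a * (mfps_nth g b * mfps_nth h l))"
    by (rule sum.reindex_bij_witness [of _
          "\<lambda>((a, m), (b, l)). ((\<lambda>i. a i + b i, l), (a, b))"
          "\<lambda>((k, l), (a, b)). ((a, \<lambda>i. b i + l i), (b, l))"])
       (auto simp: msplits_def add.assoc mult.assoc)
  also have "\<dots> =
      (\<Sum>(a, m)\<in>msplits n. \<Sum>(b, l)\<in>msplits m. mfps_nth f a * (mfps_nth g b * mfps_nth h l))"
    by (subst sum.Sigma [symmetric]) (auto simp: case_prod_beta)
  also have "\<dots> = mfps_nth (f * (g * h)) n"
    by (simp add: mfps_nth_mult sum_distrib_left case_prod_beta)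
  finally show "mfps_nth ((f * g) * h) n = mfps_nth (f * (g * h)) n" .
qed

lemma mfps_one_mult: "1 * f = (f :: ('v::finite, 'a::comm_semiring_1) mfps)"
proof (rule mfps_eqI)
  fix n
  have "mfps_nth (1 * f) n = (\<Sum>(k, l)\<in>msplits n. mfps_nth 1 k * mfps_nth f l)"
    by (simp add: mfps_nth_mult)
  also have "\<dots> = (\<Sum>(k, l)\<in>{(\<lambda>_ :: 'v. 0, n)}. mfps_nth 1 k * mfps_nth f l)"
  proof (rule sum.mono_neutral_right)
    show "{(\<lambda>_. 0, n)} \<subseteq> msplits n" by (simp add: msplits_def)
    have "a = (\<lambda>_. 0) \<Longrightarrow> b = n" if "(a, b) \<in> msplits n" for a b
      using that by (auto simp: msplits_def)
    then show "\<forall>p\<in>msplits n - {(\<lambda>_. 0, n)}. (case p of (k, l) \<Rightarrow> mfps_nth 1 k * mfps_nth f l) = 0"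
      by (auto simp: mfps_nth_one split: if_splits)
  qed simp
  finally show "mfps_nth (1 * f) n = mfps_nth f n"
    by (simp add: mfps_nth_one)
qed

instance mfps :: (finite, comm_ring_1) comm_ring_1
proof
  fix f g h :: "('a, 'b) mfps"
  show "f * g * h = f * (g * h)" by (rule mfps_mult_assoc)
  show "f * g = g * f" by (rule mfps_mult_commute)
  show "1 * f = f" by (rule mfps_one_mult)
  show "(f + g) * h = f * h + g * h"
    by (rule mfps_eqI) (simp add: mfps_nth_mult case_prod_beta distrib_right sum.distrib)
  show "(0 :: ('a, 'b) mfps) \<noteq> 1"
  proof
    assume "(0 :: ('a, 'b) mfps) = 1"
    then have "mfps_nth (0 :: ('a, 'b) mfps) (\<lambda>_. 0) = mfps_nth (1 :: ('a, 'b) mfps) (\<lambda>_. 0)"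
      by (rule arg_cong)
    then show False by (simp add: mfps_nth_one)
  qed
qed (rule mfps_eqI; simp add: add_ac)+

definition mfps_const :: "'a::zero \<Rightarrow> ('v, 'a) mfps" where
  "mfps_const a = Abs_mfps (\<lambda>n. if n = (\<lambda>_. 0) then a else 0)"

definition mfps_X :: "'v \<Rightarrow> ('v, 'a::{zero, one}) mfps" where
  "mfps_X j = Abs_mfps (\<lambda>n. if n = (\<lambda>i. if i = j then 1 else 0) then 1 else 0)"

text \<open>
  The power \<open>f\<^sup>y\<close> of a series \<open>f\<close> with constant term 1, as the binomial series in
  \<open>u = f - 1\<close>. Only finitely many terms contribute to a given coefficient, see
  \<open>mfps_nth_power_eq_0\<close> below; for other constant terms the definition is meaningless.
\<close>

definition mfps_powr :: "('v::finite, 'a::field_char_0) mfps \<Rightarrow> 'a \<Rightarrow> ('v, 'a) mfps" where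
  "mfps_powr f y =
     Abs_mfps (\<lambda>n. \<Sum>k\<le>mdegree n. (y gchoose k) * mfps_nth ((f - 1) ^ k) n)"

lemma mfps_nth_power_eq_0:
  fixes u :: "('v::finite, 'a::comm_ring_1) mfps"
  assumes u: "mfps_nth u (\<lambda>_. 0) = 0" and "mdegree n < k"
  shows "mfps_nth (u ^ k) n = 0"
  using \<open>mdegree n < k\<close>
proof (induction k arbitrary: n)
  case (Suc k)
  have "mfps_nth u a * mfps_nth (u ^ k) b = 0" if ab: "(a, b) \<in> msplits n" for a b
  proof (cases "a = (\<lambda>_. 0)")
    case False
    then have "mdegree a > 0" by (auto simp: mdegree_def fun_eq_iff neq0_conv [symmetric] simp del: neq0_conv)
    moreover have "mdegree a + mdegree b = mdegree n"
      using ab by (auto simp: msplits_def mdegree_def sum.distrib)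
    ultimately show ?thesis using Suc by simp
  qed (simp add: u)
  then show ?case by (auto simp: mfps_nth_mult intro!: sum.neutral)
qed simp


section \<open>Multiple Meixner polynomials of the second kind\<close>

definition is_mmeixner2 :: "('r::finite \<Rightarrow> real) \<Rightarrow> real \<Rightarrow> ('r \<Rightarrow> nat) \<Rightarrow> real poly \<Rightarrow> bool" where
  "is_mmeixner2 \<beta> c n p \<longleftrightarrow>
     lead_coeff p = 1 \<and> degree p = mdegree n \<and>
     (\<forall>j. \<forall>l<n j.
        (\<lambda>k. poly p (real k) * real k ^ l * (pochhammer (\<beta> j) k * c ^ k / fact k)) sums 0)"

definition mmeixner2 :: "('r::finite \<Rightarrow> real) \<Rightarrow> real \<Rightarrow> ('r \<Rightarrow> nat) \<Rightarrow> real poly" where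
  "mmeixner2 \<beta> c n = (THE p. is_mmeixner2 \<beta> c n p)"

end

theory Submission
  imports Defs "HOL-Analysis.Generalised_Binomial_Theorem"
begin

text \<open>
  Put \<open>a = c / (1 - c)\<close> and let \<open>T\<close> be the linear map sending \<open>x gchoose m\<close> to the polynomial
  \<open>a\<^sup>m (b)\<^sub>m / m!\<close> in \<open>b\<close>. The binomial series gives
  \<open>\<Sum>k. p(k) (b)\<^sub>k c\<^sup>k / k! = (1 - c) powr (- b) * (T p)(b)\<close>, so \<open>p\<close> satisfies the orthogonality
  conditions iff \<open>T p\<close> vanishes at all points \<open>\<beta> j + l\<close> with \<open>l < n j\<close>; this determines \<open>T p\<close>
  up to a scalar. With \<open>s j = 1 + a t\<^sub>j\<close>, \<open>P = \<Prod>j. s j\<close>, \<open>S = \<Prod>j. s j powr (- \<beta> j)\<close> and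
  \<open>u = (1 - 1/P) / a\<close>, the right-hand side is \<open>S (1 + u)\<^sup>x\<close>. Applying \<open>T\<close> coefficientwise yields
  \<open>S (1 - a u) powr (- b) = S P\<^sup>b = \<Prod>j. s j powr (b - \<beta> j)\<close>, whose coefficients are the products
  of the \<open>a ^ n j * (b - \<beta> j gchoose n j)\<close>, with the required zeros and leading coefficient.
  The laws of real powers of series follow from the case of natural exponents, since all
  coefficients are polynomials in the exponent.
\<close>

section \<open>Multivariate formal power series\<close>

lemma mdegree_msplits: "(k, l) \<in> msplits n \<Longrightarrow> mdegree k + mdegree l = mdegree n"
  by (auto simp: msplits_def mdegree_def sum.distrib)

lemma zero_msplits_iff [simp]: "(k, l) \<in> msplits (\<lambda>_. 0) \<longleftrightarrow> k = (\<lambda>_. 0) \<and> l = (\<lambda>_. 0)"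
  by (auto simp: msplits_def fun_eq_iff)

lemma mfps_nth_mult_zero:
  fixes f g :: "('v::finite, 'a::comm_ring_1) mfps"
  shows "mfps_nth (f * g) (\<lambda>_. 0) = mfps_nth f (\<lambda>_. 0) * mfps_nth g (\<lambda>_. 0)"
proof -
  have "msplits (\<lambda>_. 0) = {(\<lambda>_ :: 'v. 0, \<lambda>_. 0)}"
    by auto
  then show ?thesis
    by (simp add: mfps_nth_mult)
qed

lemma mfps_nth_prod_zero:
  fixes f :: "'b \<Rightarrow> ('v::finite, 'a::comm_ring_1) mfps"
  assumes "\<And>j. j \<in> A \<Longrightarrow> mfps_nth (f j) (\<lambda>_. 0) = 1"
  shows "mfps_nth (prod f A) (\<lambda>_. 0) = 1"
  using assms
  by (induction A rule: infinite_finite_induct) (auto simp: mfps_nth_one mfps_nth_mult_zero)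

lemma mfps_nth_const_mult [simp]:
  fixes f :: "('v::finite, 'a::comm_ring_1) mfps"
  shows "mfps_nth (mfps_const a * f) n = a * mfps_nth f n"
proof -
  have "mfps_nth (mfps_const a * f) n =
      (\<Sum>(k, l)\<in>{(\<lambda>_ :: 'v. 0, n)}. mfps_nth (mfps_const a) k * mfps_nth f l)"
    unfolding mfps_nth_mult
  proof (rule sum.mono_neutral_right)
    show "{(\<lambda>_. 0, n)} \<subseteq> msplits n"
      by (simp add: msplits_def)
    have "l = n" if "(\<lambda>_. 0, l) \<in> msplits n" for l
      using that by (auto simp: msplits_def)
    then show "\<forall>p\<in>msplits n - {(\<lambda>_. 0, n)}.
        (case p of (k, l) \<Rightarrow> mfps_nth (mfps_const a) k * mfps_nth f l) = 0"
      by (auto simp: mfps_const_def split: if_splits)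
  qed simp
  then show ?thesis
    by (simp add: mfps_const_def)
qed

text \<open>Needed to pass between powers of two series that differ by a scalar, as
  \<open>Q - 1\<close> and \<open>u\<close> do in the main proof.\<close>

lemma mfps_const_mult_power:
  fixes f :: "('v::finite, 'a::comm_ring_1) mfps"
  shows "mfps_nth (g * (mfps_const a * f) ^ k) n = a ^ k * mfps_nth (g * f ^ k) n"
proof -
  have "mfps_nth (g * (mfps_const a ^ k * h)) n = a ^ k * mfps_nth (g * h) n" for h
  proof (induction k arbitrary: n)
    case (Suc k)
    have "g * (mfps_const a ^ Suc k * h) = mfps_const a * (g * (mfps_const a ^ k * h))"
      by (simp add: algebra_simps)
    then show ?case
      by (simp only: mfps_nth_const_mult Suc power_Suc mult.assoc)
  qed simp
  then show ?thesis
    by (simp add: power_mult_distrib)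
qed

lemma mfps_nth_of_nat_mult [simp]:
  fixes f :: "('v::finite, 'a::comm_ring_1) mfps"
  shows "mfps_nth (of_nat k * f) n = of_nat k * mfps_nth f n"
  by (induction k) (simp_all add: distrib_right)

lemma mfps_nth_sum: "mfps_nth (sum f A) n = (\<Sum>x\<in>A. mfps_nth (f x :: (_ :: finite, _ :: comm_ring_1) mfps) n)"
  by (induction A rule: infinite_finite_induct) auto

lemma mfps_nth_X_power:
  "mfps_nth ((mfps_X j :: ('v::finite, 'a::comm_ring_1) mfps) ^ k) n =
     (if n = (\<lambda>i. if i = j then k else 0) then 1 else 0)"
proof (induction k arbitrary: n)
  case 0
  show ?case
    by (auto simp: mfps_nth_one)
next
  case (Suc k)
  let ?e = "\<lambda>k i. if i = j then k else (0::nat)"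
  have X: "mfps_nth (mfps_X j :: ('v, 'a) mfps) k = (if k = ?e 1 then 1 else 0)" for k
    by (simp add: mfps_X_def)
  have "mfps_nth (mfps_X j ^ Suc k :: ('v, 'a) mfps) n =
      (\<Sum>p\<in>msplits n. if p = (?e 1, ?e k) then 1 else 0)"
    unfolding power_Suc mfps_nth_mult
    by (rule sum.cong) (auto simp: Suc X split: if_splits)
  also have "\<dots> = (if (?e 1, ?e k) \<in> msplits n then 1 else 0)"
    by simp
  also have "(?e 1, ?e k) \<in> msplits n \<longleftrightarrow> n = ?e (Suc k)"
    by (auto simp: msplits_def fun_eq_iff)
  finally show ?case .
qed

text \<open>Each \<open>F j\<close> involves only its own variable, so a split of \<open>n\<close>
  contributes only if one part is supported at \<open>j\<close> and the other away from
  \<open>j\<close>; this leaves a single split.\<close>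

lemma mfps_nth_prod_separate:
  fixes F :: "'v::finite \<Rightarrow> ('v, 'a::comm_ring_1) mfps"
  assumes F: "\<And>j n. mfps_nth (F j) n = (if \<forall>i. i \<noteq> j \<longrightarrow> n i = 0 then f j (n j) else 0)"
  shows "mfps_nth (\<Prod>j\<in>J. F j) n =
    (if \<forall>i. i \<notin> J \<longrightarrow> n i = 0 then \<Prod>j\<in>J. f j (n j) else 0)"
proof -
  have "finite J"
    by simp
  then show ?thesis
  proof (induction J arbitrary: n rule: finite_induct)
    case empty
    show ?case
      by (auto simp: mfps_nth_one fun_eq_iff)
  next
    case (insert j J)
    let ?k = "\<lambda>i. if i = j then n j else 0" and ?l = "n(j := 0)"
    have "mfps_nth (F j * prod F J) n =
        (\<Sum>(k, l)\<in>{(?k, ?l)}. mfps_nth (F j) k * mfps_nth (prod F J) l)"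
      unfolding mfps_nth_mult
    proof (rule sum.mono_neutral_right)
      show "{(?k, ?l)} \<subseteq> msplits n"
        by (auto simp: msplits_def)
      have "mfps_nth (F j) k * mfps_nth (prod F J) l = 0"
        if kl: "(k, l) \<in> msplits n" and ne: "(k, l) \<noteq> (?k, ?l)" for k l
      proof (rule ccontr)
        assume *: "mfps_nth (F j) k * mfps_nth (prod F J) l \<noteq> 0"
        then have "\<forall>i. i \<noteq> j \<longrightarrow> k i = 0"
          using F[of j k] by (auto split: if_splits)
        moreover from * have "\<forall>i. i \<notin> J \<longrightarrow> l i = 0"
          using insert.IH[of l] by (auto split: if_splits)
        moreover have "k i + l i = n i" for i
          using kl by (auto simp: msplits_def)
        ultimately have "k = ?k \<and> l = ?l"
          using insert.hyps by (auto simp: fun_eq_iff) (metis add.right_neutral add_0)+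
        with ne show False
          by simp
      qed
      then show "\<forall>p\<in>msplits n - {(?k, ?l)}.
          (case p of (k, l) \<Rightarrow> mfps_nth (F j) k * mfps_nth (prod F J) l) = 0"
        by auto
    qed simp
    also have "\<dots> = f j (n j) * (if \<forall>i. i \<notin> J \<longrightarrow> ?l i = 0 then \<Prod>i\<in>J. f i (?l i) else 0)"
      by (simp add: F insert.IH)
    also have "(\<Prod>i\<in>J. f i (?l i)) = (\<Prod>i\<in>J. f i (n i))"
      by (rule prod.cong) (use insert.hyps in auto)
    finally show ?case
      using insert.hyps by auto
  qed
qed


section \<open>Polynomial bases\<close>

lemma poly_pochhammer: "poly (pochhammer p m) x = pochhammer (poly p x) m"
  by (induction m) (simp_all add: pochhammer_Suc)

lemma pochhammer_linear_poly:
  fixes a b :: "'a::idom"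
  assumes "a \<noteq> 0"
  shows "degree (pochhammer [:b, a:] m) = m" "lead_coeff (pochhammer [:b, a:] m) = a ^ m"
proof -
  have "degree (pochhammer [:b, a:] m) = m \<and> lead_coeff (pochhammer [:b, a:] m) = a ^ m"
  proof (induction m)
    case (Suc m)
    have "[:b, a:] + of_nat m = [:b + of_nat m, a:]"
      by (simp add: of_nat_poly)
    moreover have "pochhammer [:b, a:] m \<noteq> 0"
      using Suc assms by (metis leading_coeff_0_iff power_not_zero)
    ultimately have "degree (pochhammer [:b, a:] (Suc m)) = Suc m"
        "lead_coeff (pochhammer [:b, a:] (Suc m)) = lead_coeff (pochhammer [:b, a:] m) * a"
      unfolding pochhammer_Suc lead_coeff_mult using Suc assms
      by (simp_all add: degree_mult_eq del: mult_pCons_right)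
    then show ?case
      using Suc by (metis power_Suc2)
  qed simp
  then show "degree (pochhammer [:b, a:] m) = m" "lead_coeff (pochhammer [:b, a:] m) = a ^ m"
    by auto
qed

text \<open>Strong induction on the degree: subtracting the multiple of \<open>q d\<close> with the
  same leading coefficient lowers the degree. It serves to change bases among polynomials of degree
  below \<open>n\<close>.\<close>

lemma graded_basis_induct:
  fixes q :: "nat \<Rightarrow> 'a::field poly"
  assumes q: "\<And>i. i < n \<Longrightarrow> degree (q i) = i" "\<And>i. i < n \<Longrightarrow> q i \<noteq> 0"
    and P: "\<And>i. i < n \<Longrightarrow> P (q i)" "P 0" "\<And>f g. P f \<Longrightarrow> P g \<Longrightarrow> P (f + g)"
      "\<And>a f. P f \<Longrightarrow> P (smult a f)"
    and p: "p = 0 \<or> degree p < n"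
  shows "P p"
  using p
proof (induction "degree p" arbitrary: p rule: less_induct)
  case less
  show ?case
  proof (cases "p = 0")
    case True
    then show ?thesis
      using P(2) by simp
  next
    case False
    define d where "d = degree p"
    have d: "d < n"
      using less.prems False by (simp add: d_def)
    define r where "r = p - smult (lead_coeff p / lead_coeff (q d)) (q d)"
    have "degree r \<le> d"
      unfolding r_def by (rule degree_diff_le) (use q(1)[OF d] in \<open>simp_all add: d_def\<close>)
    moreover have "coeff (q d) d \<noteq> 0"
      using q(1)[OF d] q(2)[OF d] by (metis leading_coeff_0_iff)
    then have "coeff r d = 0"
      using q(1)[OF d] by (simp add: r_def) (simp add: d_def)
    ultimately have "r = 0 \<or> degree r < d"
      by (metis eq_zero_or_degree_less)
    then have "P r"
      using less.hyps[of r] P(2) d by (auto simp: d_def)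
    moreover have "p = r + smult (lead_coeff p / lead_coeff (q d)) (q d)"
      by (simp add: r_def)
    ultimately show ?thesis
      using P(1)[OF d] P(3,4) by metis
  qed
qed

text \<open>Evaluation at \<open>b = - m\<close> gives a triangular system: terms of index above
  \<open>m\<close> contain the factor 0, and those below vanish by induction.\<close>

lemma pochhammer_sum_independent:
  fixes A :: "nat \<Rightarrow> 'a::field_char_0"
  assumes "\<And>b. (\<Sum>m<N. A m * pochhammer b m) = 0" and "m < N"
  shows "A m = 0"
  using \<open>m < N\<close>
proof (induction m rule: less_induct)
  case (less m)
  have "A i * pochhammer (- of_nat m) i = 0" if "i \<noteq> m" "i < N" for i
    using less that by (cases "i < m") (auto simp: pochhammer_of_nat_eq_0_iff)
  then have "(\<Sum>i<N. A i * pochhammer (- of_nat m) i) = (\<Sum>i\<in>{m}. A i * pochhammer (- of_nat m) i)"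
    by (intro sum.mono_neutral_right) (use less.prems in auto)
  then show ?case
    using assms(1) by (simp add: pochhammer_of_nat_eq_0_iff)
qed

text \<open>Written through the Pochhammer symbol of \<open>- x\<close>, the polynomial takes its
  degree and leading coefficient from \<open>pochhammer_linear_poly\<close>.\<close>

definition gbinomial_poly :: "nat \<Rightarrow> 'a::field_char_0 poly" where
  "gbinomial_poly m = smult ((- 1) ^ m / fact m) (pochhammer [:0, - 1:] m)"

lemma poly_gbinomial_poly [simp]: "poly (gbinomial_poly m) x = x gchoose m"
  by (simp add: gbinomial_poly_def poly_pochhammer gbinomial_pochhammer)

lemma degree_gbinomial_poly: "degree (gbinomial_poly m) = m"
  by (simp add: gbinomial_poly_def pochhammer_linear_poly)

lemma lead_coeff_gbinomial_poly: "lead_coeff (gbinomial_poly m) = 1 / fact m"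
proof -
  have "lead_coeff (gbinomial_poly m :: 'a poly) = (- 1) ^ m / fact m * (- 1) ^ m"
    by (simp only: gbinomial_poly_def lead_coeff_smult)
       (subst pochhammer_linear_poly, auto)
  then show ?thesis
    by (simp flip: power_mult_distrib)
qed

lemma gbinomial_poly_nonzero: "gbinomial_poly m \<noteq> 0"
  using lead_coeff_gbinomial_poly[of m] by (metis fact_nonzero leading_coeff_0_iff divide_eq_0_iff zero_neq_one)


section \<open>Real powers of power series\<close>

text \<open>The cut-off in \<open>mfps_powr\<close> depends on the coefficient. A bound
  \<open>N\<close> common to all splits of \<open>n\<close> lets the sums be swapped; the added
  terms vanish because \<open>f - 1\<close> has constant term 0.\<close>

lemma mfps_nth_mult_powr:
  fixes f g :: "('v::finite, 'a::field_char_0) mfps"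
  assumes f: "mfps_nth f (\<lambda>_. 0) = 1" and "mdegree n \<le> N"
  shows "mfps_nth (g * mfps_powr f y) n = (\<Sum>m\<le>N. (y gchoose m) * mfps_nth (g * (f - 1) ^ m) n)"
proof -
  have powr: "mfps_nth (mfps_powr f y) l = (\<Sum>m\<le>N. (y gchoose m) * mfps_nth ((f - 1) ^ m) l)"
    if "(k, l) \<in> msplits n" for k l
    unfolding mfps_powr_def mfps_nth_Abs_mfps
  proof (rule sum.mono_neutral_left)
    show "{..mdegree l} \<subseteq> {..N}"
      using mdegree_msplits[OF that] assms(2) by auto
    show "\<forall>m\<in>{..N} - {..mdegree l}. (y gchoose m) * mfps_nth ((f - 1) ^ m) l = 0"
      using f by (auto simp: mfps_nth_one intro!: mfps_nth_power_eq_0)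
  qed simp
  have "mfps_nth (g * mfps_powr f y) n =
      (\<Sum>(k, l)\<in>msplits n. \<Sum>m\<le>N. (y gchoose m) * (mfps_nth g k * mfps_nth ((f - 1) ^ m) l))"
    unfolding mfps_nth_mult
    by (rule sum.cong) (auto simp: powr sum_distrib_left algebra_simps)
  also have "\<dots> = (\<Sum>m\<le>N. \<Sum>(k, l)\<in>msplits n. (y gchoose m) * (mfps_nth g k * mfps_nth ((f - 1) ^ m) l))"
    by (simp add: case_prod_unfold) (rule sum.swap)
  also have "\<dots> = (\<Sum>m\<le>N. (y gchoose m) * mfps_nth (g * (f - 1) ^ m) n)"
    by (simp add: mfps_nth_mult sum_distrib_left case_prod_unfold)
  finally show ?thesis .
qed

lemma mfps_powr_of_nat:
  fixes f :: "('v::finite, 'a::field_char_0) mfps"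
  assumes f: "mfps_nth f (\<lambda>_. 0) = 1"
  shows "mfps_powr f (of_nat k) = f ^ k"
proof (rule mfps_eqI)
  fix n :: "'v \<Rightarrow> nat"
  \<comment> \<open>\<open>N\<close> must be at least \<open>mdegree n\<close> for the binomial
    series and at least \<open>k\<close> for the binomial theorem, whose terms beyond
    \<open>k\<close> are 0.\<close>
  define N where "N = max k (mdegree n)"
  have "f ^ k = (\<Sum>m\<le>k. of_nat (k choose m) * (f - 1) ^ m)"
    using binomial_ring[of "f - 1" 1 k] by simp
  then have "mfps_nth (f ^ k) n = (\<Sum>m\<le>k. of_nat (k choose m) * mfps_nth ((f - 1) ^ m) n)"
    by (simp add: mfps_nth_sum)
  also have "\<dots> = (\<Sum>m\<le>N. of_nat (k choose m) * mfps_nth ((f - 1) ^ m) n)"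
    by (rule sum.mono_neutral_left) (auto simp: N_def)
  also have "\<dots> = mfps_nth (1 * mfps_powr f (of_nat k)) n"
    by (subst mfps_nth_mult_powr[OF f, of n N]) (auto simp: N_def binomial_gbinomial)
  finally show "mfps_nth (mfps_powr f (of_nat k)) n = mfps_nth (f ^ k) n"
    by simp
qed

text \<open>Polynomial dependence on the exponent is what carries an identity between powers from
  natural exponents to arbitrary ones.\<close>

definition poly_family :: "('a::field_char_0 \<Rightarrow> ('v, 'a) mfps) \<Rightarrow> bool" where
  "poly_family F \<longleftrightarrow> (\<forall>n. \<exists>p. \<forall>y. mfps_nth (F y) n = poly p y)"

lemma poly_family_const: "poly_family (\<lambda>_. f)"
  unfolding poly_family_def by (intro allI exI[of _ "[:mfps_nth f _:]"]) simp

lemma poly_family_mult: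
  fixes F G :: "'a::field_char_0 \<Rightarrow> ('v::finite, 'a) mfps"
  assumes "poly_family F" "poly_family G"
  shows "poly_family (\<lambda>y. F y * G y)"
proof -
  obtain p q where "\<And>n y. mfps_nth (F y) n = poly (p n) y" "\<And>n y. mfps_nth (G y) n = poly (q n) y"
    using assms unfolding poly_family_def by metis
  then have "mfps_nth (F y * G y) n = poly (\<Sum>(k, l)\<in>msplits n. p k * q l) y" for y n
    by (simp add: mfps_nth_mult poly_sum case_prod_unfold)
  then show ?thesis
    unfolding poly_family_def by blast
qed

lemma poly_family_powr: "poly_family (mfps_powr f)"
proof -
  have "mfps_nth (mfps_powr f y) n =
      poly (\<Sum>k\<le>mdegree n. smult (mfps_nth ((f - 1) ^ k) n) (gbinomial_poly k)) y" for y n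
    by (simp add: mfps_powr_def poly_sum mult.commute)
  then show ?thesis
    unfolding poly_family_def by blast
qed

lemma poly_family_shift:
  assumes "poly_family F"
  shows "poly_family (\<lambda>y. F (y + z))"
proof -
  obtain p where "\<And>n y. mfps_nth (F y) n = poly (p n) y"
    using assms unfolding poly_family_def by metis
  then have "mfps_nth (F (y + z)) n = poly (pcompose (p n) [:z, 1:]) y" for y n
    by (simp add: poly_pcompose add.commute)
  then show ?thesis
    unfolding poly_family_def by blast
qed

text \<open>For each coefficient, the difference of the two polynomials has infinitely many roots,
  namely all naturals.\<close>

lemma poly_family_eqI:
  assumes "poly_family F" "poly_family G" and nat: "\<And>k. F (of_nat k) = G (of_nat k)"
  shows "F y = G y"
proof (rule mfps_eqI)
  fix n
  obtain p q where pq: "\<And>y. mfps_nth (F y) n = poly p y" "\<And>y. mfps_nth (G y) n = poly q y"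
    using assms(1,2) unfolding poly_family_def by metis
  have "range of_nat \<subseteq> {y. poly (p - q) y = 0}"
    using nat pq by auto (metis)
  moreover have "infinite (range (of_nat :: nat \<Rightarrow> 'a))"
    by (simp add: finite_image_iff inj_of_nat)
  ultimately have "p - q = 0"
    using poly_roots_finite finite_subset by blast
  then show "mfps_nth (F y) n = mfps_nth (G y) n"
    using pq by simp
qed

lemma mfps_powr_add:
  fixes f :: "('v::finite, 'a::field_char_0) mfps"
  assumes f: "mfps_nth f (\<lambda>_. 0) = 1"
  shows "mfps_powr f (y + z) = mfps_powr f y * mfps_powr f z"
proof (rule poly_family_eqI[where F = "\<lambda>y. mfps_powr f (y + z)"])
  fix k
  \<comment> \<open>The exponents are freed one at a time: first \<open>z\<close> beside a natural
    exponent \<open>k\<close>, then \<open>y\<close>.\<close>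
  have "mfps_powr f (z + of_nat k) = mfps_powr f z * mfps_powr f (of_nat k)"
  proof (rule poly_family_eqI[where F = "\<lambda>z. mfps_powr f (z + of_nat k)"])
    fix l
    have "mfps_powr f (of_nat l + of_nat k) = f ^ (l + k)"
      using mfps_powr_of_nat[OF f, of "l + k"] by simp
    then show "mfps_powr f (of_nat l + of_nat k) = mfps_powr f (of_nat l) * mfps_powr f (of_nat k)"
      by (simp add: mfps_powr_of_nat f power_add)
  qed (intro poly_family_mult poly_family_const poly_family_powr poly_family_shift)+
  then show "mfps_powr f (of_nat k + z) = mfps_powr f (of_nat k) * mfps_powr f z"
    by (simp add: ac_simps)
qed (intro poly_family_mult poly_family_const poly_family_powr poly_family_shift)+

lemma mfps_powr_mult:
  fixes f g :: "('v::finite, 'a::field_char_0) mfps"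
  assumes "mfps_nth f (\<lambda>_. 0) = 1" "mfps_nth g (\<lambda>_. 0) = 1"
  shows "mfps_powr (f * g) y = mfps_powr f y * mfps_powr g y"
  by (rule poly_family_eqI[where F = "mfps_powr (f * g)"])
     (use assms in \<open>auto intro!: poly_family_mult poly_family_powr
        simp: mfps_powr_of_nat mfps_nth_mult_zero power_mult_distrib\<close>)

lemma mfps_powr_one [simp]: "mfps_powr (1 :: ('v::finite, 'a::field_char_0) mfps) y = 1"
  by (rule poly_family_eqI[where F = "mfps_powr 1"])
     (auto intro: poly_family_powr poly_family_const simp: mfps_powr_of_nat mfps_nth_one)

lemma mfps_powr_prod:
  fixes f :: "'b \<Rightarrow> ('v::finite, 'a::field_char_0) mfps"
  assumes "\<And>j. j \<in> J \<Longrightarrow> mfps_nth (f j) (\<lambda>_. 0) = 1"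
  shows "mfps_powr (\<Prod>j\<in>J. f j) y = (\<Prod>j\<in>J. mfps_powr (f j) y)"
  using assms
  by (induction J rule: infinite_finite_induct)
     (auto simp: mfps_powr_mult mfps_nth_prod_zero)

lemma mfps_powr_minus:
  fixes f :: "('v::finite, 'a::field_char_0) mfps"
  assumes "mfps_nth f (\<lambda>_. 0) = 1"
  shows "mfps_powr f y * mfps_powr f (- y) = 1"
  using mfps_powr_add[OF assms, of y "- y"] mfps_powr_of_nat[OF assms, of 0] by simp

lemma mfps_nth_powr_zero:
  fixes f :: "('v::finite, 'a::field_char_0) mfps"
  shows "mfps_nth (mfps_powr f y) (\<lambda>_. 0) = 1"
  by (simp add: mfps_powr_def mdegree_def mfps_nth_one)

section \<open>Explicit coefficients of powers of linear series\<close>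

lemma mfps_nth_powr_linear:
  "mfps_nth (mfps_powr (1 + mfps_const a * mfps_X j) y) n =
     (if \<forall>i. i \<noteq> j \<longrightarrow> n i = 0 then a ^ n j * (y gchoose n j) else (0 :: 'a::field_char_0))"
proof -
  \<comment> \<open>A power of a multiple of one variable is a single monomial, so only the term
    \<open>k = n j\<close> of the binomial series can contribute.\<close>
  have "mfps_nth ((mfps_const a * mfps_X j) ^ k :: ('b, 'a) mfps) n =
      (if n = (\<lambda>i. if i = j then k else 0) then a ^ k else 0)" for k
    using mfps_const_mult_power[of 1 a "mfps_X j" k n] by (simp add: mfps_nth_X_power)
  then have "mfps_nth (mfps_powr (1 + mfps_const a * mfps_X j) y) n =
      (\<Sum>k\<le>mdegree n. if k = n j \<and> (\<forall>i. i \<noteq> j \<longrightarrow> n i = 0) then a ^ n j * (y gchoose n j) else 0)"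
    unfolding mfps_powr_def mfps_nth_Abs_mfps
    by (intro sum.cong) (auto simp: fun_eq_iff)
  moreover have "n j \<le> mdegree n"
    unfolding mdegree_def by (rule member_le_sum) auto
  ultimately show ?thesis
    by (cases "\<forall>i. i \<noteq> j \<longrightarrow> n i = 0") auto
qed

lemma mfps_nth_prod_powr_linear:
  fixes n :: "'v::finite \<Rightarrow> nat"
  shows "mfps_nth (\<Prod>j\<in>UNIV. mfps_powr (1 + mfps_const a * mfps_X j) (y j)) n =
    (\<Prod>j\<in>UNIV. a ^ n j * (y j gchoose n j :: 'a::field_char_0))"
  by (subst mfps_nth_prod_separate[where f = "\<lambda>j k. a ^ k * (y j gchoose k)"])
     (auto simp: mfps_nth_powr_linear)


section \<open>Negative binomial weights\<close>

text \<open>Terms with \<open>k < m\<close> vanish; after a shift by \<open>m\<close> the rest is a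
  constant multiple of the binomial series of \<open>(1 - c) powr (- (b + m))\<close>.\<close>

lemma sums_gchoose_weight:
  fixes b c :: real
  assumes "0 < c" "c < 1"
  shows "(\<lambda>k. (real k gchoose m) * (pochhammer b k * c ^ k / fact k)) sums
    ((1 - c) powr (- b) * ((c / (1 - c)) ^ m * pochhammer b m / fact m))"
    (is "?f sums ?s")
proof -
  have "?f (k + m) = pochhammer b m * c ^ m / fact m * ((- (b + m) gchoose k) * (- c) ^ k)" for k
  proof -
    have gchoose: "real (k + m) gchoose m = fact (k + m) / (fact k * fact m)"
      using binomial_fact[of m "k + m", where 'a = real] by (simp add: binomial_gbinomial)
    have shift: "pochhammer b (k + m) = pochhammer b m * pochhammer (b + m) k"
      using pochhammer_product'[of b m k] by (simp add: add.commute)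
    have negate: "(- (b + m) gchoose k) * (- c) ^ k = pochhammer (b + m) k / fact k * c ^ k"
      by (cases "even k") (simp_all add: gbinomial_pochhammer add.commute)
    show ?thesis
      unfolding gchoose shift negate by (simp add: power_add mult_ac)
  qed
  moreover have "(\<lambda>k. (- (b + m) gchoose k) * (- c) ^ k) sums (1 + - c) powr (- (b + m))"
    by (rule gen_binomial_real) (use assms in auto)
  then have "(\<lambda>k. pochhammer b m * c ^ m / fact m * ((- (b + m) gchoose k) * (- c) ^ k)) sums
      (pochhammer b m * c ^ m / fact m * (1 - c) powr (- (b + m)))"
    by (intro sums_mult) simp
  moreover have "(1 - c) powr (- (b + m)) = (1 - c) powr (- b) / (1 - c) ^ m"
    using assms by (simp add: powr_diff powr_realpow)
  ultimately have "(\<lambda>k. ?f (k + m)) sums ?s"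
    by (simp add: power_divide mult_ac)
  then show ?thesis
    by (subst (asm) sums_zero_iff_shift) (auto simp flip: binomial_gbinomial)
qed

text \<open>The finite sum on the right is \<open>T p\<close> at \<open>b\<close>, and its prefactor
  is nonzero; hence a vanishing series amounts to a root of \<open>T p\<close>.\<close>

lemma sums_poly_weight:
  fixes b c :: real
  assumes "0 < c" "c < 1" and p: "p = (\<Sum>m\<in>I. smult (A m) (gbinomial_poly m))"
  shows "(\<lambda>k. poly p (real k) * (pochhammer b k * c ^ k / fact k)) sums
    ((1 - c) powr (- b) * (\<Sum>m\<in>I. A m * (c / (1 - c)) ^ m / fact m * pochhammer b m))"
proof -
  have "(\<lambda>k. \<Sum>m\<in>I. A m * ((real k gchoose m) * (pochhammer b k * c ^ k / fact k))) sums
    (\<Sum>m\<in>I. A m * ((1 - c) powr (- b) * ((c / (1 - c)) ^ m * pochhammer b m / fact m)))"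
    by (intro sums_sum sums_mult sums_gchoose_weight assms)
  moreover have "(\<Sum>m\<in>I. A m * ((real k gchoose m) * (pochhammer b k * c ^ k / fact k))) =
      poly p (real k) * (pochhammer b k * c ^ k / fact k)" for k
    by (simp only: p poly_sum poly_smult poly_gbinomial_poly sum_distrib_right mult.assoc)
  moreover have "(\<Sum>m\<in>I. A m * ((1 - c) powr (- b) * ((c / (1 - c)) ^ m * pochhammer b m / fact m))) =
      (1 - c) powr (- b) * (\<Sum>m\<in>I. A m * (c / (1 - c)) ^ m / fact m * pochhammer b m)"
    by (simp add: sum_distrib_left mult_ac)
  ultimately show ?thesis
    by simp
qed

text \<open>
  Multiplying the weight with parameter \<open>b\<close> by the polynomial \<open>(b + x)\<^sub>l\<close> shifts the
  parameter to \<open>b + l\<close>.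
\<close>

lemma moments_zero_iff:
  fixes b c :: real
  assumes "0 < b"
  shows "(\<forall>l<n. (\<lambda>k. poly p (real k) * real k ^ l * (pochhammer b k * c ^ k / fact k)) sums 0) \<longleftrightarrow>
    (\<forall>l<n. (\<lambda>k. poly p (real k) * (pochhammer (b + real l) k * c ^ k / fact k)) sums 0)"
proof -
  define Z where "Z q \<longleftrightarrow>
    (\<lambda>k. poly p (real k) * poly q (real k) * (pochhammer b k * c ^ k / fact k)) sums 0" for q
  have Z0: "Z 0"
    by (simp add: Z_def)
  have Zadd: "Z (f + g)" if "Z f" "Z g" for f g
    using sums_add[OF that[unfolded Z_def]] by (simp add: Z_def algebra_simps add_divide_distrib)
  have Zsmult: "Z (smult a f)" if "Z f" for a f
    using sums_mult[OF that[unfolded Z_def], of a] by (simp add: Z_def mult_ac)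
  have shift: "Z (pochhammer [:b, 1:] l) \<longleftrightarrow>
      (\<lambda>k. poly p (real k) * (pochhammer (b + real l) k * c ^ k / fact k)) sums 0" for l
  proof -
    \<comment> \<open>Both sides equal \<open>pochhammer b (k + l)\<close>.\<close>
    have "pochhammer (b + real k) l * pochhammer b k = pochhammer b l * pochhammer (b + real l) k" for k
      using pochhammer_product'[of b k l] pochhammer_product'[of b l k] by (simp add: ac_simps)
    then have *: "poly p (real k) * poly (pochhammer [:b, 1:] l) (real k) * (pochhammer b k * c ^ k / fact k) =
        pochhammer b l * (poly p (real k) * (pochhammer (b + real l) k * c ^ k / fact k))" for k
      by (simp add: poly_pochhammer)
    \<comment> \<open>Positivity of \<open>b\<close> makes this factor nonzero, so it cancels from
      the series.\<close>
    have "pochhammer b l \<noteq> 0"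
      using pochhammer_pos[OF assms, of l] by simp
    then show ?thesis
      unfolding Z_def * by (rule sums_mult_iff[where d = 0, unfolded mult_zero_right])
  qed
  \<comment> \<open>\<open>Z\<close> is preserved by linear combinations, and both families are
    graded bases of the polynomials of degree below \<open>n\<close>.\<close>
  have "(\<forall>l<n. Z (monom 1 l)) \<longleftrightarrow> (\<forall>l<n. Z (pochhammer [:b, 1:] l))"
  proof (intro iffI allI impI)
    fix l assume *: "\<forall>l<n. Z (monom 1 l)" "l < n"
    show "Z (pochhammer [:b, 1:] l)"
      by (rule graded_basis_induct[where P = Z and q = "monom 1" and n = n])
         (use * in \<open>auto simp: degree_monom_eq pochhammer_linear_poly Z0 Zadd Zsmult\<close>)
  next
    fix l assume *: "\<forall>l<n. Z (pochhammer [:b, 1:] l)" "l < n"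
    have nz: "pochhammer [:b, 1:] i \<noteq> 0" for i
      using pochhammer_linear_poly(2)[of 1 b i] by auto
    show "Z (monom 1 l)"
      by (rule graded_basis_induct[where P = Z and q = "pochhammer [:b, 1:]" and n = n])
         (use * in \<open>auto simp: nz degree_monom_eq pochhammer_linear_poly Z0 Zadd Zsmult\<close>)
  qed
  then show ?thesis
    unfolding shift by (simp add: Z_def poly_monom)
qed


section \<open>The multiple Meixner polynomials\<close>

text \<open>
  \<open>T\<close> maps such a \<open>p\<close> to a polynomial of degree less than \<open>mdegree n\<close> vanishing at the \<open>mdegree n\<close> points \<open>\<beta> j + l\<close>; they
  are distinct because the \<open>\<beta> j\<close> do not differ by integers.
\<close>

lemma orthogonal_imp_zero:
  fixes \<beta> :: "'r::finite \<Rightarrow> real"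
  assumes c: "0 < c" "c < 1" and \<beta>: "\<And>j. 0 < \<beta> j"
    and nint: "\<And>i j. i \<noteq> j \<Longrightarrow> \<beta> i - \<beta> j \<notin> \<int>"
    and deg: "p = 0 \<or> degree p < mdegree n"
    and orth: "\<And>j l. l < n j \<Longrightarrow>
      (\<lambda>k. poly p (real k) * real k ^ l * (pochhammer (\<beta> j) k * c ^ k / fact k)) sums 0"
  shows "p = 0"
proof -
  define N where "N = mdegree n"
  have "\<exists>A. p = (\<Sum>m<N. smult (A m) (gbinomial_poly m))"
  proof (rule graded_basis_induct[where q = gbinomial_poly and n = N])
    fix i assume "i < N"
    then have "gbinomial_poly i = (\<Sum>m<N. smult (if m = i then 1 else 0) (gbinomial_poly m :: real poly))"
      by (simp add: if_distrib if_distribR cong: if_cong)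
    then show "\<exists>A. gbinomial_poly i = (\<Sum>m<N. smult (A m) (gbinomial_poly m :: real poly))"
      by (rule exI[of _ "\<lambda>m. if m = i then 1 else 0"])
  next
    show "\<exists>A. 0 = (\<Sum>m<N. smult (A m) (gbinomial_poly m :: real poly))"
      by (rule exI[of _ "\<lambda>_. 0"]) simp
  next
    fix f g :: "real poly"
    assume "\<exists>A. f = (\<Sum>m<N. smult (A m) (gbinomial_poly m))" "\<exists>A. g = (\<Sum>m<N. smult (A m) (gbinomial_poly m))"
    then obtain A B where "f = (\<Sum>m<N. smult (A m) (gbinomial_poly m))"
        "g = (\<Sum>m<N. smult (B m) (gbinomial_poly m))"
      by blast
    then show "\<exists>A. f + g = (\<Sum>m<N. smult (A m) (gbinomial_poly m))"
      by (intro exI[of _ "\<lambda>m. A m + B m"]) (simp add: smult_add_left sum.distrib)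
  next
    fix a f assume "\<exists>A. f = (\<Sum>m<N. smult (A m) (gbinomial_poly m :: real poly))"
    then obtain A where "f = (\<Sum>m<N. smult (A m) (gbinomial_poly m))"
      by blast
    then show "\<exists>A. smult a f = (\<Sum>m<N. smult (A m) (gbinomial_poly m))"
      by (intro exI[of _ "\<lambda>m. a * A m"]) (simp add: poly_eq_iff coeff_sum sum_distrib_left mult.assoc)
  qed (use deg in \<open>auto simp: degree_gbinomial_poly gbinomial_poly_nonzero N_def\<close>)
  then obtain A where A: "p = (\<Sum>m<N. smult (A m) (gbinomial_poly m))"
    by blast
  \<comment> \<open>\<open>q\<close> is \<open>T p\<close>, with coefficients \<open>B\<close> in
    the basis of rising factorials.\<close>
  define B where "B m = A m * (c / (1 - c)) ^ m / fact m" for m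
  define q where "q = (\<Sum>m<N. smult (B m) (pochhammer [:0, 1:] m))"
  have q: "poly q b = (\<Sum>m<N. B m * pochhammer b m)" for b
    by (simp add: q_def poly_sum poly_pochhammer)
  have root: "poly q (\<beta> j + real l) = 0" if "l < n j" for j l
  proof -
    have "(\<lambda>k. poly p (real k) * (pochhammer (\<beta> j + real l) k * c ^ k / fact k)) sums 0"
      using moments_zero_iff[OF \<beta>[of j], of "n j" p c] orth that by blast
    then have "(1 - c) powr (- (\<beta> j + real l)) * poly q (\<beta> j + real l) = 0"
      using sums_poly_weight[OF c A, of "\<beta> j + real l"] sums_unique2 unfolding q B_def by blast
    then show ?thesis
      using c by simp
  qed
  have "inj_on (\<lambda>(j, l). \<beta> j + real l) (SIGMA j:UNIV. {..<n j})"
  proof (rule inj_onI, clarsimp)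
    fix i j k l assume eq: "\<beta> i + real k = \<beta> j + real l"
    then have "\<beta> i - \<beta> j = of_int (int l - int k)"
      by simp
    then have "i = j"
      using nint by (metis Ints_of_int)
    then show "i = j \<and> k = l"
      using eq by simp
  qed
  then have "card ((\<lambda>(j, l). \<beta> j + real l) ` (SIGMA j:UNIV. {..<n j})) = N"
    by (simp add: card_image N_def mdegree_def)
  moreover have "(\<lambda>(j, l). \<beta> j + real l) ` (SIGMA j:UNIV. {..<n j}) \<subseteq> {b. poly q b = 0}"
    using root by auto
  ultimately have card: "N \<le> card {b. poly q b = 0}" if "q \<noteq> 0"
    using card_mono[OF poly_roots_finite[OF that]] by metis
  have "q = 0"
  proof (rule ccontr)
    assume "q \<noteq> 0"
    then have "N \<le> degree q"
      using card card_poly_roots_bound le_trans by blast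
    \<comment> \<open>The bound \<open>N - 1\<close> on the degree is strict only for positive
      \<open>N\<close>; for \<open>N = 0\<close> the empty sum would make \<open>q\<close>
      zero.\<close>
    moreover have "N \<noteq> 0"
      using \<open>q \<noteq> 0\<close> unfolding q_def by (cases N) auto
    then have "degree q < N"
      unfolding q_def
      by (intro le_less_trans[OF degree_sum_le[of _ _ "N - 1"]])
         (auto simp: pochhammer_linear_poly intro!: order_trans[OF degree_smult_le])
    ultimately show False
      by simp
  qed
  then have "(\<Sum>m<N. B m * pochhammer b m) = 0" for b
    using q by (metis poly_0)
  \<comment> \<open>Injectivity of \<open>T\<close>: rising factorials are independent, and
    \<open>B m\<close> is a nonzero multiple of \<open>A m\<close>.\<close>
  then have "B m = 0" if "m < N" for m
    using pochhammer_sum_independent[of B N] that by blast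
  then have "A m = 0" if "m < N" for m
    using that c by (simp add: B_def)
  then show ?thesis
    by (simp add: A)
qed

text \<open>Two candidates are monic of the same degree, so their difference is zero or of lower
  degree, and \<open>orthogonal_imp_zero\<close> applies to it.\<close>

lemma mmeixner2_eqI:
  fixes \<beta> :: "'r::finite \<Rightarrow> real"
  assumes c: "0 < c" "c < 1" and \<beta>: "\<And>j. 0 < \<beta> j"
    and nint: "\<And>i j. i \<noteq> j \<Longrightarrow> \<beta> i - \<beta> j \<notin> \<int>"
    and p: "is_mmeixner2 \<beta> c n p"
  shows "mmeixner2 \<beta> c n = p"
  unfolding mmeixner2_def
proof (rule the_equality[where P = "is_mmeixner2 \<beta> c n", OF p])
  fix q assume q: "is_mmeixner2 \<beta> c n q"
  have deg: "degree p = mdegree n" "degree q = mdegree n" "lead_coeff p = 1" "lead_coeff q = 1"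
    using p q by (auto simp: is_mmeixner2_def)
  then have "degree (q - p) \<le> mdegree n" "coeff (q - p) (mdegree n) = 0"
    using degree_diff_le[of q "mdegree n" p] by auto
  then have "q - p = 0 \<or> degree (q - p) < mdegree n"
    by (metis eq_zero_or_degree_less)
  moreover have "(\<lambda>k. poly (q - p) (real k) * real k ^ l * (pochhammer (\<beta> j) k * c ^ k / fact k)) sums 0"
    if "l < n j" for j l
  proof -
    let ?w = "\<lambda>k. pochhammer (\<beta> j) k * c ^ k / fact k"
    have "(\<lambda>k. poly q (real k) * real k ^ l * ?w k) sums 0" "(\<lambda>k. poly p (real k) * real k ^ l * ?w k) sums 0"
      using p q that unfolding is_mmeixner2_def by blast+
    from sums_diff[OF this] show ?thesis
      by (simp only: poly_diff left_diff_distrib diff_0_right)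
  qed
  ultimately have "q - p = 0"
    using orthogonal_imp_zero[of c \<beta> "q - p" n] c \<beta> nint by blast
  then show "q = p"
    by simp
qed

section \<open>The generating function\<close>

theorem theorem2:
  fixes \<beta> :: "'r::finite \<Rightarrow> real" and c x :: real
  assumes "0 < c" and "c < 1"
    and "\<And>j. 0 < \<beta> j"
    and "\<And>i j. i \<noteq> j \<Longrightarrow> \<beta> i - \<beta> j \<notin> \<int>"
  shows "Abs_mfps (\<lambda>n. poly (mmeixner2 \<beta> c n) x / (\<Prod>j\<in>UNIV. fact (n j))) =
    mfps_powr
      (1 - mfps_const (1 / c) * (1 - (\<Prod>j\<in>UNIV. 1 + mfps_const (c / (1 - c)) * mfps_X j))) x *
    (\<Prod>j\<in>UNIV. mfps_powr (1 + mfps_const (c / (1 - c)) * mfps_X j) (- x - \<beta> j))"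
proof -
  define a where "a = c / (1 - c)"
  have a: "a \<noteq> 0"
    using assms(1,2) by (simp add: a_def)
  define s :: "'r \<Rightarrow> ('r, real) mfps" where "s j = 1 + mfps_const a * mfps_X j" for j
  define P where "P = (\<Prod>j\<in>UNIV. s j)"
  define S where "S = (\<Prod>j\<in>UNIV. mfps_powr (s j) (- \<beta> j))"
  define Q where "Q = mfps_powr P (- 1)"
  define u where "u = mfps_const (1 / a) * (1 - Q)"
  have s0: "mfps_nth (s j) (\<lambda>_. 0) = 1" for j
    by (simp add: s_def mfps_nth_one mfps_X_def fun_eq_iff)
  have P0: "mfps_nth P (\<lambda>_. 0) = 1"
    unfolding P_def by (rule mfps_nth_prod_zero) (rule s0)
  have Q0: "mfps_nth Q (\<lambda>_. 0) = 1"
    by (simp add: Q_def mfps_nth_powr_zero)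
  have u0: "mfps_nth (1 + u) (\<lambda>_. 0) = 1"
    by (simp add: u_def mfps_nth_one Q0)
  have PQ: "P * Q = 1"
    using mfps_powr_minus[OF P0, of 1] mfps_powr_of_nat[OF P0, of 1] by (simp add: Q_def)
  \<comment> \<open>\<open>Q\<close> is the inverse of \<open>P\<close>, so both sides are inverse
    to \<open>mfps_powr P (- b)\<close>.\<close>
  have powr_Q: "mfps_powr Q (- b) = mfps_powr P b" for b
  proof -
    have "mfps_powr P (- b) * mfps_powr Q (- b) = 1"
      using mfps_powr_mult[OF P0 Q0, of "- b"] PQ by simp
    then have "mfps_powr P b * (mfps_powr P (- b) * mfps_powr Q (- b)) = mfps_powr P b"
      by simp
    then show ?thesis
      using mfps_powr_minus[OF P0, of b] by (simp flip: mult.assoc)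
  qed
  have S_powr: "S * mfps_powr P b = (\<Prod>j\<in>UNIV. mfps_powr (s j) (b - \<beta> j))" for b
  proof -
    have "mfps_powr (s j) (b - \<beta> j) = mfps_powr (s j) (- \<beta> j) * mfps_powr (s j) b" for j
      using mfps_powr_add[OF s0, of j "- \<beta> j" b] by simp
    then show ?thesis
      by (simp add: S_def P_def mfps_powr_prod s0 prod.distrib)
  qed
  have "1 - mfps_const (1 / c) * (1 - P) = P * (1 + u)"
  proof -
    \<comment> \<open>This relation together with \<open>P * Q = 1\<close> splits the factor
      \<open>P\<close> off the base.\<close>
    have "1 / c = 1 + 1 / a"
      using assms(1,2) by (simp add: a_def field_simps)
    then have "mfps_const (1 / c) = 1 + (mfps_const (1 / a) :: ('r, real) mfps)"
      by (intro mfps_eqI) (simp add: mfps_const_def mfps_nth_one)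
    moreover have "P * (1 + u) = P + mfps_const (1 / a) * (P - P * Q)"
      by (simp add: u_def algebra_simps)
    ultimately show ?thesis
      unfolding PQ by (simp only:) (simp add: algebra_simps)
  qed
  \<comment> \<open>The power \<open>x\<close> of \<open>P\<close> cancels against the power
    \<open>- x\<close> contained in the product over \<open>j\<close>.\<close>
  then have rhs: "mfps_powr (1 - mfps_const (1 / c) * (1 - P)) x *
      (\<Prod>j\<in>UNIV. mfps_powr (s j) (- x - \<beta> j)) = S * mfps_powr (1 + u) x"
    using mfps_powr_mult[OF P0 u0, of x] mfps_powr_minus[OF P0, of x]
    by (simp add: mult_ac flip: S_powr) (metis mult.assoc mult.commute mult_1)
  have "poly (mmeixner2 \<beta> c n) x / (\<Prod>j\<in>UNIV. fact (n j)) = mfps_nth (S * mfps_powr (1 + u) x) n" for n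
  proof -
    define N where "N = mdegree n"
    define F where "F = (\<Prod>j\<in>UNIV. fact (n j) :: real)"
    have F: "F \<noteq> 0"
      by (simp add: F_def)
    \<comment> \<open>\<open>p\<close> is the candidate for the Meixner polynomial: its values are
      the coefficients of the right-hand side at \<open>n\<close>, with \<open>F\<close> clearing
      the factorials of the exponential generating function.\<close>
    define A where "A m = F * mfps_nth (S * u ^ m) n" for m
    define p where "p = (\<Sum>m\<le>N. smult (A m) (gbinomial_poly m))"
    have p: "poly p y = F * mfps_nth (S * mfps_powr (1 + u) y) n" for y
      using mfps_nth_mult_powr[OF u0, of n N S y]
      by (simp add: p_def A_def N_def poly_sum sum_distrib_left mult_ac)
    \<comment> \<open>The left side is \<open>T p\<close>. It arises from the same coefficients of
      \<open>S * u ^ m\<close> when \<open>1 + u\<close> is replaced by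
      \<open>Q = 1 - a u\<close>.\<close>
    have transform: "(\<Sum>m\<le>N. A m * a ^ m / fact m * pochhammer b m) =
        F * (\<Prod>j\<in>UNIV. a ^ n j * (b - \<beta> j gchoose n j))" for b
    proof -
      have "Q - 1 = mfps_const (- a) * u"
        using a by (intro mfps_eqI) (simp add: u_def)
      then have "mfps_nth (S * (Q - 1) ^ m) n = (- a) ^ m * mfps_nth (S * u ^ m) n" for m
        by (simp only: mfps_const_mult_power)
      then have "mfps_nth (S * mfps_powr Q (- b)) n =
          (\<Sum>m\<le>N. (- b gchoose m) * ((- a) ^ m * mfps_nth (S * u ^ m) n))"
        by (subst mfps_nth_mult_powr[OF Q0, of n N]) (simp_all add: N_def)
      also have "\<dots> = (\<Sum>m\<le>N. a ^ m / fact m * pochhammer b m * mfps_nth (S * u ^ m) n)"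
      proof (rule sum.cong)
        fix m
        \<comment> \<open>The sign in \<open>- b gchoose m\<close> cancels the sign of
          \<open>(- a) ^ m\<close>.\<close>
        have "(- b gchoose m) * (- a) ^ m = a ^ m / fact m * pochhammer b m"
          by (cases "even m") (simp_all add: gbinomial_pochhammer)
        then show "(- b gchoose m) * ((- a) ^ m * mfps_nth (S * u ^ m) n) =
            a ^ m / fact m * pochhammer b m * mfps_nth (S * u ^ m) n"
          by (simp flip: mult.assoc)
      qed simp
      finally have "(\<Sum>m\<le>N. a ^ m / fact m * pochhammer b m * mfps_nth (S * u ^ m) n) =
          (\<Prod>j\<in>UNIV. a ^ n j * (b - \<beta> j gchoose n j))"
        by (simp only: powr_Q S_powr s_def mfps_nth_prod_powr_linear)
      moreover have "(\<Sum>m\<le>N. A m * a ^ m / fact m * pochhammer b m) =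
          F * (\<Sum>m\<le>N. a ^ m / fact m * pochhammer b m * mfps_nth (S * u ^ m) n)"
        by (simp add: A_def sum_distrib_left mult_ac)
      ultimately show ?thesis
        by simp
    qed
    \<comment> \<open>The coefficient of \<open>p\<close> at \<open>N\<close> is
      \<open>A N / fact N\<close>, so this makes \<open>p\<close> monic. The value comes from
      comparing top coefficients of the two forms of \<open>T p\<close> in
      \<open>transform\<close>.\<close>
    have A_N: "A N = fact N"
    proof -
      \<comment> \<open>For \<open>m < N\<close> the rising factorial has degree below
        \<open>N\<close>, so only the last summand reaches the coefficient at
        \<open>N\<close>.\<close>
      have lead: "coeff (pochhammer [:0, 1:] m) N = (if m = N then 1 else 0 :: real)" if "m \<le> N" for m
        using pochhammer_linear_poly[of "1 :: real" 0 m] that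
        by (auto intro!: coeff_eq_0)
      define q1 where "q1 = (\<Sum>m\<le>N. smult (A m * a ^ m / fact m) (pochhammer [:0, 1:] m))"
      define r where "r j = smult (a ^ n j) (pcompose (gbinomial_poly (n j)) [:- \<beta> j, 1:])" for j
      define q2 where "q2 = smult F (\<Prod>j\<in>UNIV. r j)"
      have "poly q1 b = poly q2 b" for b
        using transform[of b]
        by (simp add: q1_def q2_def r_def poly_sum poly_prod poly_pochhammer poly_pcompose)
      then have "q1 = q2"
        using poly_eq_poly_eq_iff by blast
      have lead_r: "lead_coeff (r j) = a ^ n j / fact (n j)" for j
        unfolding r_def lead_coeff_smult by (subst lead_coeff_comp) (simp_all add: lead_coeff_gbinomial_poly)
      then have "r j \<noteq> 0" for j
        using a by (metis divide_eq_0_iff fact_nonzero leading_coeff_0_iff power_not_zero)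
      moreover have "degree (r j) = n j" for j
        using a by (simp add: r_def degree_pcompose degree_gbinomial_poly)
      ultimately have "degree (\<Prod>j\<in>UNIV. r j) = N"
        by (subst degree_prod_eq_sum_degree) (auto simp: N_def mdegree_def)
      then have "coeff q2 N = F * (\<Prod>j\<in>UNIV. lead_coeff (r j))"
        by (metis q2_def coeff_smult lead_coeff_prod)
      \<comment> \<open>The denominators multiply to \<open>F\<close>, and the exponents of
        \<open>a\<close> add up to \<open>N\<close>.\<close>
      also have "\<dots> = a ^ N"
        using F by (simp add: lead_r prod_dividef power_sum F_def N_def mdegree_def)
      also have "coeff q2 N = (\<Sum>m\<in>{N}. A m * a ^ m / fact m * coeff (pochhammer [:0, 1:] m) N)"
        unfolding \<open>q1 = q2\<close>[symmetric] q1_def coeff_sum coeff_smult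
        by (rule sum.mono_neutral_right) (auto simp: lead)
      finally have "A N * a ^ N / fact N = a ^ N"
        by (simp add: lead)
      then show ?thesis
        using a by (simp add: field_simps)
    qed
    have "coeff p N = (\<Sum>m\<in>{N}. A m * coeff (gbinomial_poly m) N)"
      unfolding p_def coeff_sum coeff_smult
      by (rule sum.mono_neutral_right) (auto simp: degree_gbinomial_poly intro!: coeff_eq_0)
    then have coeff_p: "coeff p N = 1"
      using lead_coeff_gbinomial_poly[of N, where 'a = real] by (simp add: A_N degree_gbinomial_poly)
    have "degree p \<le> N"
      unfolding p_def
      by (rule degree_sum_le) (auto simp: degree_gbinomial_poly intro!: order_trans[OF degree_smult_le])
    moreover have "N \<le> degree p"
      using coeff_p by (simp add: le_degree)
    ultimately have "degree p = N"
      by simp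
    moreover have "(\<lambda>k. poly p (real k) * (pochhammer (\<beta> j + real l) k * c ^ k / fact k)) sums 0"
      if "l < n j" for j l
    proof -
      \<comment> \<open>The factor at \<open>i = j\<close> is \<open>l gchoose n j\<close>, which is
        0 because \<open>l < n j\<close>.\<close>
      have "(\<Prod>i\<in>UNIV. a ^ n i * (\<beta> j + real l - \<beta> i gchoose n i)) = 0"
        using that by (auto intro!: exI[of _ j] simp flip: binomial_gbinomial)
      then show ?thesis
        using sums_poly_weight[OF assms(1,2) p_def, of "\<beta> j + real l", folded a_def]
        by (simp only: transform mult_zero_right)
    qed
    \<comment> \<open>\<open>moments_zero_iff\<close> turns the conditions at the shifted parameters
      back into moments against powers of \<open>k\<close>.\<close>
    ultimately have "is_mmeixner2 \<beta> c n p"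
      using coeff_p moments_zero_iff[OF assms(3), where p = p and c = c] unfolding is_mmeixner2_def N_def by simp
    then have "mmeixner2 \<beta> c n = p"
      using mmeixner2_eqI[where \<beta> = \<beta> and c = c and n = n and p = p] assms by blast
    then show ?thesis
      using F p by (simp add: F_def)
  qed
  then have "Abs_mfps (\<lambda>n. poly (mmeixner2 \<beta> c n) x / (\<Prod>j\<in>UNIV. fact (n j))) =
      S * mfps_powr (1 + u) x"
    by (intro mfps_eqI) simp
  then show ?thesis
    unfolding rhs[symmetric] by (simp add: P_def s_def a_def)
qed

end
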